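(* Let $(X,d)$ be a complete metric space. For $r=1,2$ let $F_{P_r}:X\to X$ be a continuous function and let $\mathcal A_r$ be a subset of the set of attractors of $F_{P_r}$. Put $\alpha(1)=2$, $\alpha(2)=1$. Let $Im\in X$. Suppose that for $r=1,2$ the following conditions hold: (a) The sets $\mathcal A_1$ and $\mathcal A_2$ are finite and disjoint. (b) $Im$ belongs to the basin $\mathcal B(a)$ (with respect to $F_{P_1}$) of some $a\in\mathcal A_1$. (c) Every $a\in\mathcal A_r$ belongs to the basin $\mathcal B(a')$ (with respect to $F_{P_{\alpha(r)}}$) of some $a'\in\mathcal A_{\alpha(r)}$ together with an open ball of a certain radius $\delta(a)>0$ around $a$: $B_{\delta(a)}(a)\subset\mathcal B(a')$. (d) For every $a\in\mathcal A_r$ the convergence of the sequence of functions $(F_{P_r}^{[n]})_n$ to $a$ is locally uniform at $a$: there exists $\delta(a)>0$ such that for any $\epsilon>0$ there exists $n_0$ such that $F_{P_r}^{[n]}(B_{\delta(a)}(a))\subseteq B_\epsilon(a)$ for any $n\ge n_0$. Then the sequence $$U(Im,nsteps_1,nsteps_2)=Im\xrightarrow{[F_{P_1}]^{nsteps_1}}T_1\xrightarrow{[F_{P_2}]^{nsteps_2}}T_2\xrightarrow{[F_{P_1}]^{nsteps_1}}T_3\xrightarrow{[F_{P_2}]^{nsteps_2}}T_4\xrightarrow{[F_{P_1}]^{nsteps_1}}\cdots$$ is a bipartite convergent sequence of the second type, converging to an orbit $(b_0,\dots,b_{K-1})$ ($K>0$ even) consisting of alternating attractors of $F_{P_1}$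 and $F_{P_2}$ ($b_h$ is an attractor of $F_{P_1}$ for even $h$ and of $F_{P_2}$ for odd $h$). The orbit elements form a loop with respect to alternating $\widehat{F_1},\widehat{F_2}$ operations: $$b_0\xrightarrow{\widehat{F_2}}b_1\xrightarrow{\widehat{F_1}}\cdots\xrightarrow{\widehat{F_2}}b_{K-1}\xrightarrow{\widehat{F_1}}b_0.$$ Moreover, the orbit elements are alternating fixed points of $\widehat{G_1}=[\widehat{F_1}\circ\widehat{F_2}]^{K/2}$ and $\widehat{G_2}=[\widehat{F_2}\circ\widehat{F_1}]^{K/2}$: $\widehat{G_1}(b_h)=b_h$ for even $h$ and $\widehat{G_2}(b_h)=b_h$ for odd $h$, $0\le h\le K-1$.
   Context: For $f:X\to X$, both $[f]^n$ and $f^{[n]}$ denote the $n$-fold composition of $f$ with itself. $B_\epsilon(x)=\{x'\in X: d(x,x')<\epsilon\}$, and $f(B_\epsilon(x))$ is the image of this ball under $f$. $f\circ g$ means: apply $g$ first. A fixed point $a$ of $f:X\to X$ is an attractor of $f$ if there is an open neighborhood $O$ of $a$ such that $f^{[n]}(y)\to a$ as $n\to\infty$ for all $y\in O$. The basin $\mathcal B(a)$ of an attractor $a$ of $f$ is the set of all $y\in X$ with $f^{[n]}(y)\to a$. For $r=1,2$, $\widehat{F_r}(x)=\lim_{n\to\infty}[F_{P_r}]^n(x)$, defined at those $x\in X$ for which the limit exists. The assertions involving $\widehat{F_r}$ at orbit elements include that the relevant limits exist. For positive integers $nsteps_1,nsteps_2$, the elements $T_i=T_i(nsteps_1,nsteps_2)$,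 $i\ge1$, are defined by $T_1=[F_{P_1}]^{nsteps_1}(Im)$, $T_{i+1}=[F_{P_2}]^{nsteps_2}(T_i)$ for odd $i$, and $T_{i+1}=[F_{P_1}]^{nsteps_1}(T_i)$ for even $i$. Bipartite convergence of the second type: $U(Im,nsteps_1,nsteps_2)$ is a bipartite convergent sequence of the second type converging to the orbit $(b_j\mid j=0,\dots,K-1)$, $K>0$, if all the $b_j\in X$ are different and for every $j=0,\dots,K-1$ the elements $T_{1+mK+j}(nsteps_1,nsteps_2)$ converge to $b_j$ as $m$, $nsteps_1$ and $nsteps_2$ tend (jointly) to infinity; that is, for every $\epsilon>0$ there is $N$ such that $d(T_{1+mK+j}(nsteps_1,nsteps_2),b_j)<\epsilon$ for all $m,nsteps_1,nsteps_2\ge N$. *)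

theory Defs
  imports "HOL-Analysis.Analysis"
begin

definition basin :: "('a::metric_space \<Rightarrow> 'a) \<Rightarrow> 'a \<Rightarrow> 'a set" where
  "basin f a = {y. (\<lambda>n. (f ^^ n) y) \<longlonglongrightarrow> a}"

definition attractor :: "('a::metric_space \<Rightarrow> 'a) \<Rightarrow> 'a \<Rightarrow> bool" where
  "attractor f a \<longleftrightarrow>
     f a = a \<and> (\<exists>S. open S \<and> a \<in> S \<and> (\<forall>y\<in>S. (\<lambda>n. (f ^^ n) y) \<longlonglongrightarrow> a))"

text \<open>The map sending \<open>x\<close> to the limit of its iterates is only partially defined; it and its
  compositions are therefore partial maps, and an equation \<open>limit_map f x = Some y\<close> includes
  the existence of the limit.\<close>

definition limit_map :: "('a::metric_space \<Rightarrow> 'a) \<Rightarrow> 'a \<rightharpoonup> 'a" where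
  "limit_map f x =
     (if convergent (\<lambda>n. (f ^^ n) x) then Some (lim (\<lambda>n. (f ^^ n) x)) else None)"

primrec map_pow :: "nat \<Rightarrow> ('a \<rightharpoonup> 'a) \<Rightarrow> 'a \<rightharpoonup> 'a" where
  "map_pow 0 g = Some"
| "map_pow (Suc n) g = g \<circ>\<^sub>m map_pow n g"

definition alpha :: "nat \<Rightarrow> nat" where
  "alpha r = (if r = 1 then 2 else 1)"

text \<open>The sequence \<open>img, T\<^sub>1, T\<^sub>2, \<dots>\<close>, with the starting point \<open>img\<close> at index \<open>0\<close>.
  Only \<open>F 1\<close> and \<open>F 2\<close> are used.\<close>

primrec bip_seq :: "(nat \<Rightarrow> 'a \<Rightarrow> 'a) \<Rightarrow> 'a \<Rightarrow> nat \<Rightarrow> nat \<Rightarrow> nat \<Rightarrow> 'a" where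
  "bip_seq F img nsteps1 nsteps2 0 = img"
| "bip_seq F img nsteps1 nsteps2 (Suc i) =
     (if even i then (F 1 ^^ nsteps1) (bip_seq F img nsteps1 nsteps2 i)
      else (F 2 ^^ nsteps2) (bip_seq F img nsteps1 nsteps2 i))"

text \<open>\<open>U nsteps1 nsteps2 i\<close> is the \<open>i\<close>-th element of the sequence, and the orbit is
  \<open>b 0, \<dots>, b (K - 1)\<close>. Requiring \<open>N \<ge> 1\<close> restricts to positive step counts.\<close>

definition bipartite_convergent_second ::
    "(nat \<Rightarrow> nat \<Rightarrow> nat \<Rightarrow> 'a::metric_space) \<Rightarrow> nat \<Rightarrow> (nat \<Rightarrow> 'a) \<Rightarrow> bool" where
  "bipartite_convergent_second U K b \<longleftrightarrow>
     K > 0 \<and> inj_on b {..<K} \<and>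
     (\<forall>j<K. \<forall>\<epsilon>>0. \<exists>N\<ge>1. \<forall>m\<ge>N. \<forall>nsteps1\<ge>N. \<forall>nsteps2\<ge>N.
        dist (U nsteps1 nsteps2 (1 + m * K + j)) (b j) < \<epsilon>)"

end

theory Submission
  imports Defs
begin

text \<open>Sending an attractor of one map to its limit under the other map is a self-map \<open>\<phi>\<close> of the
  finite set \<open>A 1 \<union> A 2\<close>; its orbit starting from the limit of \<open>img\<close> is eventually periodic, and the
  cycle it enters is the orbit sought. Since the attractors attract locally uniformly and the maps
  are continuous, there are arbitrarily small \<open>\<eta>\<close> such that, for all large step counts, every block of
  iterations maps the \<open>\<eta>\<close>-ball around each attractor \<open>x\<close> into the \<open>\<eta>\<close>-ball around \<open>\<phi> x\<close>. Hence the
  sequence \<open>T\<close> stays \<open>\<eta>\<close>-close to the \<open>\<phi>\<close>-orbit at all times, which gives joint convergence.\<close>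

lemma limit_map_eq_Some_iff: "limit_map f x = Some y \<longleftrightarrow> x \<in> basin f y"
  unfolding limit_map_def basin_def convergent_LIMSEQ_iff
  by (auto dest: limI)

lemma continuous_on_funpow:
  fixes f :: "'a::topological_space \<Rightarrow> 'a"
  assumes "continuous_on UNIV f"
  shows "continuous_on UNIV (f ^^ n)"
proof (induction n)
  case 0
  show ?case by (simp add: id_def)
next
  case (Suc n)
  then show ?case
    using continuous_on_compose[OF Suc.IH continuous_on_subset[OF assms]] by simp
qed

text \<open>Uniformity near \<open>a\<close> is carried back to any point of the basin: some iterate
  sends \<open>x\<close> into the uniform ball around \<open>a\<close>, and by continuity it sends a
  whole ball around \<open>x\<close> there. The radius \<open>\<rho>\<close> is chosen before
  \<open>\<epsilon>\<close>.\<close>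

lemma basin_locally_uniform:
  fixes f :: "'a::metric_space \<Rightarrow> 'a"
  assumes cont: "continuous_on UNIV f" and x: "x \<in> basin f a"
    and unif: "\<exists>\<delta>>0. \<forall>\<epsilon>>0. \<exists>n0. \<forall>n\<ge>n0. (f ^^ n) ` ball a \<delta> \<subseteq> ball a \<epsilon>"
  shows "\<exists>\<rho>>0. \<forall>\<epsilon>>0. \<exists>n0. \<forall>n\<ge>n0. (f ^^ n) ` ball x \<rho> \<subseteq> ball a \<epsilon>"
proof -
  obtain \<delta> where \<delta>: "\<delta> > 0" "\<And>\<epsilon>. \<epsilon> > 0 \<Longrightarrow> \<exists>n0. \<forall>n\<ge>n0. (f ^^ n) ` ball a \<delta> \<subseteq> ball a \<epsilon>"
    using unif by blast
  have "\<forall>\<^sub>F k in sequentially. (f ^^ k) x \<in> ball a \<delta>"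
    using x \<delta>(1) by (intro topological_tendstoD[of _ a]) (auto simp: basin_def)
  then obtain k where k: "(f ^^ k) x \<in> ball a \<delta>"
    by (auto simp: eventually_sequentially)
  have "open ((f ^^ k) -` ball a \<delta>)"
    using continuous_on_funpow[OF cont] by (intro open_vimage) auto
  then obtain \<rho> where \<rho>: "\<rho> > 0" "ball x \<rho> \<subseteq> (f ^^ k) -` ball a \<delta>"
    using k by (metis open_contains_ball vimageI)
  have "\<exists>n0. \<forall>n\<ge>n0. (f ^^ n) ` ball x \<rho> \<subseteq> ball a \<epsilon>" if "\<epsilon> > 0" for \<epsilon>
  proof -
    obtain n0 where n0: "\<And>n. n \<ge> n0 \<Longrightarrow> (f ^^ n) ` ball a \<delta> \<subseteq> ball a \<epsilon>"
      using \<delta>(2) \<open>\<epsilon> > 0\<close> by blast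
    \<comment> \<open>The first \<open>k\<close> iterations reach \<open>ball a \<delta>\<close>; at
      least \<open>n0\<close> remain.\<close>
    have "(f ^^ n) y \<in> ball a \<epsilon>" if n: "n \<ge> n0 + k" and y: "y \<in> ball x \<rho>" for n y
    proof -
      have "(f ^^ n) y = (f ^^ (n - k)) ((f ^^ k) y)"
        using n funpow_add[of "n - k" k f] by simp
      moreover have "(f ^^ k) y \<in> ball a \<delta>" using \<rho>(2) y by blast
      moreover have "(f ^^ (n - k)) ` ball a \<delta> \<subseteq> ball a \<epsilon>" using n by (intro n0) simp
      ultimately show ?thesis by (simp add: image_subset_iff del: mem_ball)
    qed
    then show ?thesis by blast
  qed
  with \<rho>(1) show ?thesis by blast
qed

text \<open>The same radius \<open>\<eta>\<close> at source and target lets the inclusions be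
  chained without loss. As each \<open>\<rho>\<close> is independent of the target precision,
  \<open>\<eta>\<close> can be fixed below all of them and then used as that precision. Finiteness
  of \<open>S\<close> gives a positive minimum and a common threshold for \<open>n\<close>.\<close>

lemma uniform_small_ball_map:
  fixes f :: "'a::metric_space \<Rightarrow> 'a \<Rightarrow> 'a" and \<epsilon> :: real
  assumes "finite S" and "\<epsilon> > 0"
    and unif: "\<And>x. x \<in> S \<Longrightarrow>
      \<exists>\<rho>>0. \<forall>\<epsilon>>0. \<exists>n0. \<forall>n\<ge>n0. (f x ^^ n) ` ball x \<rho> \<subseteq> ball (\<phi> x) \<epsilon>"
  shows "\<exists>\<eta>>0. \<eta> \<le> \<epsilon> \<and>
    (\<forall>\<^sub>F n in sequentially. \<forall>x\<in>S. (f x ^^ n) ` ball x \<eta> \<subseteq> ball (\<phi> x) \<eta>)"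
proof -
  obtain \<rho> where \<rho>: "\<And>x. x \<in> S \<Longrightarrow> \<rho> x > 0"
    "\<And>x \<epsilon>. x \<in> S \<Longrightarrow> \<epsilon> > 0 \<Longrightarrow> \<exists>n0. \<forall>n\<ge>n0. (f x ^^ n) ` ball x (\<rho> x) \<subseteq> ball (\<phi> x) \<epsilon>"
    using unif by metis
  define \<eta> where "\<eta> = Min (insert \<epsilon> (\<rho> ` S))"
  have \<eta>: "\<eta> > 0" "\<eta> \<le> \<epsilon>" "\<And>x. x \<in> S \<Longrightarrow> \<eta> \<le> \<rho> x"
    using assms(1,2) \<rho>(1) by (auto simp: \<eta>_def)
  have "\<forall>\<^sub>F n in sequentially. (f x ^^ n) ` ball x \<eta> \<subseteq> ball (\<phi> x) \<eta>" if x: "x \<in> S" for x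
    using \<rho>(2)[OF x \<eta>(1)] image_mono[OF subset_ball[OF \<eta>(3)[OF x], of x]]
    unfolding eventually_sequentially by (meson order_trans)
  with assms(1) \<eta>(1,2) show ?thesis
    by (auto intro!: exI[of _ \<eta>] eventually_ball_finite)
qed

text \<open>By pigeonhole some value recurs. \<open>K\<close> is the least gap between equal terms
  at any position, so every window of length \<open>K\<close> is free of repetitions, even before
  the cycle is entered at \<open>s\<close>.\<close>

lemma eventually_cyclic:
  fixes \<phi> :: "'a \<Rightarrow> 'a"
  assumes "finite S" and "x \<in> S" and "\<phi> ` S \<subseteq> S"
  obtains K s where "K > 0" and "\<And>n. n \<ge> s \<Longrightarrow> (\<phi> ^^ (n + K)) x = (\<phi> ^^ n) x"
    and "\<And>n. inj_on (\<lambda>j. (\<phi> ^^ (n + j)) x) {..<K}"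
proof -
  let ?P = "\<lambda>k. k > 0 \<and> (\<exists>n. (\<phi> ^^ (n + k)) x = (\<phi> ^^ n) x)"
  have "range (\<lambda>n. (\<phi> ^^ n) x) \<subseteq> S"
  proof (rule image_subsetI)
    show "(\<phi> ^^ n) x \<in> S" for n
      using assms(2,3) by (induction n) auto
  qed
  then have "\<not> inj (\<lambda>n. (\<phi> ^^ n) x)"
    using assms(1) finite_imageD finite_subset infinite_UNIV_nat by blast
  then obtain i j where "i < j" "(\<phi> ^^ i) x = (\<phi> ^^ j) x"
    by (auto simp: inj_on_def) (metis linorder_neqE_nat)
  then have "?P (j - i)" by (auto intro!: exI[of _ i])
  then have K: "?P (LEAST k. ?P k)" by (rule LeastI)
  define K where "K = (LEAST k. ?P k)"
  obtain s where s: "(\<phi> ^^ (s + K)) x = (\<phi> ^^ s) x"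
    using K unfolding K_def by blast
  show ?thesis
  proof
    show "K > 0" using K unfolding K_def by blast
    show "(\<phi> ^^ (n + K)) x = (\<phi> ^^ n) x" if "n \<ge> s" for n
      using that
    proof (induction n rule: dec_induct)
      case base
      show ?case by (rule s)
    next
      case (step n)
      then show ?case by simp
    qed
    show "inj_on (\<lambda>j. (\<phi> ^^ (n + j)) x) {..<K}" for n
    proof (rule linorder_inj_onI)
      fix i j assume ij: "i < j" "i \<in> {..<K}" "j \<in> {..<K}"
      show "(\<phi> ^^ (n + i)) x \<noteq> (\<phi> ^^ (n + j)) x"
      proof
        assume "(\<phi> ^^ (n + i)) x = (\<phi> ^^ (n + j)) x"
        with ij(1) have "?P (j - i)" by (auto intro!: exI[of _ "n + i"])
        moreover have "j - i < K" using ij by auto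
        ultimately show False unfolding K_def by (blast dest: not_less_Least)
      qed
    qed auto
  qed
qed

text \<open>On an invariant set where the partial map is total, iterating it never meets
  \<open>None\<close>.\<close>

lemma map_pow_eq_funpow:
  assumes "x \<in> S" and "\<And>y. y \<in> S \<Longrightarrow> g y = Some (f y)" and "f ` S \<subseteq> S"
  shows "map_pow n g x = Some ((f ^^ n) x)"
proof -
  have "(f ^^ n) x \<in> S \<and> map_pow n g x = Some ((f ^^ n) x)"
    using assms by (induction n) (auto simp: map_comp_def)
  then show ?thesis ..
qed

theorem theorem5:
  fixes F :: "nat \<Rightarrow> 'a::complete_space \<Rightarrow> 'a"
    and A :: "nat \<Rightarrow> 'a set"
    and img :: 'a
  assumes "\<forall>r\<in>{1, 2}. continuous_on UNIV (F r)"
    and "\<forall>r\<in>{1, 2}. A r \<subseteq> {a. attractor (F r) a}"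
    and "finite (A 1)" and "finite (A 2)" and "A 1 \<inter> A 2 = {}"
    and "\<exists>a\<in>A 1. img \<in> basin (F 1) a"
    and "\<forall>r\<in>{1, 2}. \<forall>a\<in>A r. \<exists>a'\<in>A (alpha r).
           a \<in> basin (F (alpha r)) a' \<and> (\<exists>\<delta>>0. ball a \<delta> \<subseteq> basin (F (alpha r)) a')"
    and "\<forall>r\<in>{1, 2}. \<forall>a\<in>A r. \<exists>\<delta>>0. \<forall>\<epsilon>>0. \<exists>n0. \<forall>n\<ge>n0.
           (F r ^^ n) ` ball a \<delta> \<subseteq> ball a \<epsilon>"
  shows "\<exists>K b.
      bipartite_convergent_second (bip_seq F img) K b \<and>
      even K \<and>
      (\<forall>h<K. (even h \<longrightarrow> attractor (F 1) (b h)) \<and> (odd h \<longrightarrow> attractor (F 2) (b h))) \<and>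
      (\<forall>h<K. (even h \<longrightarrow> limit_map (F 2) (b h) = Some (b ((h + 1) mod K))) \<and>
             (odd h \<longrightarrow> limit_map (F 1) (b h) = Some (b ((h + 1) mod K)))) \<and>
      (\<forall>h<K. (even h \<longrightarrow>
                map_pow (K div 2) (limit_map (F 1) \<circ>\<^sub>m limit_map (F 2)) (b h) = Some (b h)) \<and>
             (odd h \<longrightarrow>
                map_pow (K div 2) (limit_map (F 2) \<circ>\<^sub>m limit_map (F 1)) (b h) = Some (b h)))"
proof -
  \<comment> \<open>\<open>f x\<close> is the map applied next once the sequence is near the
    attractor \<open>x\<close>; disjointness of \<open>A 1\<close> and \<open>A 2\<close> makes the
    else branch right on \<open>A 2\<close>. On \<open>?S\<close>, \<open>the\<close> in
    \<open>\<phi>\<close> is harmless because the limits exist by hypothesis.\<close>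
  define f where "f x = F (if x \<in> A 1 then 2 else 1)" for x
  define \<phi> where "\<phi> x = the (limit_map (f x) x)" for x
  let ?S = "A 1 \<union> A 2"
  note unif = assms(8)
  have next1: "\<phi> x \<in> A 2 \<and> x \<in> basin (F 2) (\<phi> x)" if "x \<in> A 1" for x
  proof -
    obtain y where "y \<in> A 2" "x \<in> basin (F 2) y"
      using assms(7) \<open>x \<in> A 1\<close> by (auto simp: alpha_def)
    then show ?thesis
      using that by (simp add: \<phi>_def f_def flip: limit_map_eq_Some_iff)
  qed
  have next2: "\<phi> x \<in> A 1 \<and> x \<in> basin (F 1) (\<phi> x)" if "x \<in> A 2" for x
  proof -
    obtain y where "y \<in> A 1" "x \<in> basin (F 1) y"
      using assms(7) \<open>x \<in> A 2\<close> by (auto simp: alpha_def)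
    moreover have "x \<notin> A 1" using that assms(5) by blast
    ultimately show ?thesis
      by (simp add: \<phi>_def f_def flip: limit_map_eq_Some_iff)
  qed
  have unif_step: "\<exists>\<rho>>0. \<forall>\<epsilon>>0. \<exists>n0. \<forall>n\<ge>n0. (f x ^^ n) ` ball x \<rho> \<subseteq> ball (\<phi> x) \<epsilon>"
    if "x \<in> ?S" for x
  proof (rule basin_locally_uniform)
    show "continuous_on UNIV (f x)" using assms(1) by (simp add: f_def)
    show "x \<in> basin (f x) (\<phi> x)"
      using that next1 next2 assms(5) by (auto simp: f_def)
    show "\<exists>\<delta>>0. \<forall>\<epsilon>>0. \<exists>n0. \<forall>n\<ge>n0. (f x ^^ n) ` ball (\<phi> x) \<delta> \<subseteq> ball (\<phi> x) \<epsilon>"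
    proof (cases "x \<in> A 1")
      case True
      then have "f x = F 2" "\<phi> x \<in> A 2" using next1 by (auto simp: f_def)
      then show ?thesis using unif by simp
    next
      case False
      then have "f x = F 1" "\<phi> x \<in> A 1" using that next2 by (auto simp: f_def)
      then show ?thesis using unif by simp
    qed
  qed
  obtain a where a: "a \<in> A 1" "img \<in> basin (F 1) a"
    using assms(6) by blast
  \<comment> \<open>Indices shift by one: \<open>c i\<close> is the attractor approached by element
    \<open>Suc i\<close> of the sequence, so \<open>c 0 = a\<close>.\<close>
  define c where "c i = (\<phi> ^^ i) a" for i
  have c_Suc: "c (Suc i) = \<phi> (c i)" for i by (simp add: c_def)
  have c_mem: "c i \<in> A (if even i then 1 else 2)" for i
  proof (induction i)
    case 0
    show ?case using a by (simp add: c_def)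
  next
    case (Suc i)
    then show ?case using next1 next2 by (auto simp: c_Suc split: if_splits)
  qed
  have c_even: "c i \<in> A 1" if "even i" for i using c_mem[of i] that by simp
  have c_odd: "c i \<in> A 2" if "odd i" for i using c_mem[of i] that by simp

  \<comment> \<open>\<open>N\<close> does not depend on \<open>i\<close>: errors do not accumulate
    over the blocks. This makes the convergence joint.\<close>
  have shadow: "\<exists>N\<ge>1. \<forall>n1\<ge>N. \<forall>n2\<ge>N. \<forall>i. dist (bip_seq F img n1 n2 (Suc i)) (c i) < \<epsilon>"
    if "\<epsilon> > 0" for \<epsilon> :: real
  proof -
    obtain \<eta> where \<eta>: "\<eta> > 0" "\<eta> \<le> \<epsilon>"
      "\<forall>\<^sub>F n in sequentially. \<forall>x\<in>?S. (f x ^^ n) ` ball x \<eta> \<subseteq> ball (\<phi> x) \<eta>"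
      using uniform_small_ball_map[OF _ \<open>\<epsilon> > 0\<close> unif_step] assms(3,4) by blast
    have "\<forall>\<^sub>F n in sequentially. dist ((F 1 ^^ n) img) a < \<eta>"
      using a(2) \<eta>(1) by (simp add: basin_def tendstoD)
    then have "\<forall>\<^sub>F n in sequentially. dist ((F 1 ^^ n) img) a < \<eta> \<and>
        (\<forall>x\<in>?S. (f x ^^ n) ` ball x \<eta> \<subseteq> ball (\<phi> x) \<eta>)"
      using \<eta>(3) by (rule eventually_conj)
    then obtain N where N: "\<And>n. n \<ge> N \<Longrightarrow> dist ((F 1 ^^ n) img) a < \<eta>"
      "\<And>n x. n \<ge> N \<Longrightarrow> x \<in> ?S \<Longrightarrow> (f x ^^ n) ` ball x \<eta> \<subseteq> ball (\<phi> x) \<eta>"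
      unfolding eventually_sequentially by blast
    have "bip_seq F img n1 n2 (Suc i) \<in> ball (c i) \<eta>" if "n1 \<ge> N" "n2 \<ge> N" for n1 n2 i
    proof (induction i)
      case 0
      show ?case using N(1)[OF that(1)] by (simp add: c_def dist_commute)
    next
      case (Suc i)
      \<comment> \<open>Going from element \<open>Suc i\<close> to the next one uses the parity of
        \<open>Suc i\<close>, hence \<open>F 2\<close> for even \<open>i\<close>.\<close>
      let ?n = "if even i then n2 else n1"
      have mem: "c i \<in> ?S" using c_mem[of i] by (auto split: if_splits)
      have "bip_seq F img n1 n2 (Suc (Suc i)) = (f (c i) ^^ ?n) (bip_seq F img n1 n2 (Suc i))"
        using c_even[of i] c_odd[of i] assms(5) by (auto simp: f_def)
      moreover have "(f (c i) ^^ ?n) ` ball (c i) \<eta> \<subseteq> ball (\<phi> (c i)) \<eta>"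
        using that mem by (intro N(2)) auto
      ultimately show ?case using Suc.IH unfolding c_Suc by (metis image_subset_iff)
    qed
    then have "dist (bip_seq F img n1 n2 (Suc i)) (c i) < \<epsilon>"
      if "n1 \<ge> max 1 N" "n2 \<ge> max 1 N" for n1 n2 i
      using that \<eta>(2) by (metis dist_commute less_le_trans max.boundedE mem_ball)
    then show ?thesis by (meson max.cobounded1)
  qed

  have "\<phi> ` ?S \<subseteq> ?S" using next1 next2 by blast
  then obtain K s where K: "K > 0" and per: "\<And>n. n \<ge> s \<Longrightarrow> c (n + K) = c n"
    and inj: "\<And>n. inj_on (\<lambda>j. c (n + j)) {..<K}"
    using eventually_cyclic[of ?S a \<phi>] assms(3,4) a(1) unfolding c_def by blast
  \<comment> \<open>\<open>2 * s\<close> is even and past the preperiod; an odd period would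
    identify an element of \<open>A 1\<close> with one of \<open>A 2\<close>.\<close>
  have even_K: "even K"
  proof (rule ccontr)
    assume "odd K"
    then have "c (2 * s + K) \<in> A 2" by (intro c_odd) simp
    moreover have "c (2 * s) \<in> A 1" by (intro c_even) simp
    ultimately show False using per[of "2 * s"] assms(5) by auto
  qed
  \<comment> \<open>The offset \<open>s * K\<close> is at least \<open>s\<close>, so the cycle has
    been entered; it is even, so parities of indices are kept; and it is a multiple of
    \<open>K\<close>, so \<open>b j\<close> matches the indices \<open>m * K + j\<close>.\<close>
  define b where "b j = c (s * K + j)" for j
  have sK: "s \<le> s * K" using K by simp
  have par: "even (s * K + h) \<longleftrightarrow> even h" for h using even_K by simp
  have b_per: "c (m * K + j) = b j" if "m \<ge> s" for m j
    using that
  proof (induction m rule: dec_induct)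
    case base
    show ?case by (simp add: b_def)
  next
    case (step m)
    have "s \<le> m * K + j" using step.hyps sK by (meson mult_le_mono1 order_trans trans_le_add1)
    then show ?case using per[of "m * K + j"] step.IH by (simp add: ac_simps)
  qed
  have b_mem: "even h \<Longrightarrow> b h \<in> A 1" "odd h \<Longrightarrow> b h \<in> A 2" for h
    using c_even[of "s * K + h"] c_odd[of "s * K + h"] par[of h] unfolding b_def by blast+
  have b_cyc: "b (h + K) = b h" for h
    using b_per[of "Suc s" h] by (simp add: b_def ac_simps)
  have b_Suc: "b ((h + 1) mod K) = \<phi> (b h)" if "h < K" for h
  proof -
    \<comment> \<open>Only \<open>h + 1 = K\<close> wraps around, and there periodicity gives
      \<open>b K = b 0\<close>.\<close>
    have "b ((h + 1) mod K) = b (h + 1)"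
      using that b_cyc[of 0] by (cases "h + 1 = K") auto
    then show ?thesis by (simp add: b_def c_Suc)
  qed
  \<comment> \<open>As \<open>K\<close> is even, this power is \<open>\<phi> ^^ K\<close>, which
    advances the orbit by one full period.\<close>
  have b_pow: "((\<phi> \<circ> \<phi>) ^^ (K div 2)) (b h) = b h" for h
  proof -
    have "\<phi> \<circ> \<phi> = \<phi> ^^ 2" by (simp add: eval_nat_numeral)
    then have "(\<phi> \<circ> \<phi>) ^^ (K div 2) = \<phi> ^^ K"
      using even_K by (simp add: funpow_mult)
    then have "((\<phi> \<circ> \<phi>) ^^ (K div 2)) (b h) = b (h + K)"
      using funpow_add[of K "s * K + h" \<phi>] by (simp add: b_def c_def ac_simps)
    then show ?thesis by (simp add: b_cyc)
  qed
  have lim1: "limit_map (F 2) x = Some (\<phi> x)" if "x \<in> A 1" for x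
    using next1[OF that] by (simp add: limit_map_eq_Some_iff)
  have lim2: "limit_map (F 1) x = Some (\<phi> x)" if "x \<in> A 2" for x
    using next2[OF that] by (simp add: limit_map_eq_Some_iff)
  \<comment> \<open>Two applications of \<open>\<phi>\<close> lead from \<open>A 1\<close> back to
    \<open>A 1\<close>, so \<open>A 1\<close> serves as the invariant set.\<close>
  have pow1: "map_pow n (limit_map (F 1) \<circ>\<^sub>m limit_map (F 2)) x = Some (((\<phi> \<circ> \<phi>) ^^ n) x)"
    if "x \<in> A 1" for n x
    using that next1 next2 by (intro map_pow_eq_funpow[of _ "A 1"])
      (auto simp: lim1 lim2 simp del: One_nat_def)
  have pow2: "map_pow n (limit_map (F 2) \<circ>\<^sub>m limit_map (F 1)) x = Some (((\<phi> \<circ> \<phi>) ^^ n) x)"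
    if "x \<in> A 2" for n x
    using that next1 next2 by (intro map_pow_eq_funpow[of _ "A 2"])
      (auto simp: lim1 lim2 simp del: One_nat_def)
  have conv: "\<exists>N\<ge>1. \<forall>m\<ge>N. \<forall>n1\<ge>N. \<forall>n2\<ge>N.
      dist (bip_seq F img n1 n2 (1 + m * K + j)) (b j) < \<epsilon>" if "\<epsilon> > 0" for \<epsilon> j
  proof -
    obtain N where N: "N \<ge> 1"
      "\<And>n1 n2 i. n1 \<ge> N \<Longrightarrow> n2 \<ge> N \<Longrightarrow> dist (bip_seq F img n1 n2 (Suc i)) (c i) < \<epsilon>"
      using shadow[OF \<open>\<epsilon> > 0\<close>] by blast
    have "dist (bip_seq F img n1 n2 (1 + m * K + j)) (b j) < \<epsilon>"
      \<comment> \<open>\<open>N\<close> makes the sequence close to \<open>c\<close>, while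
        \<open>m \<ge> s\<close> ensures \<open>c (m * K + j) = b j\<close>.\<close>
      if "m \<ge> max N s" "n1 \<ge> max N s" "n2 \<ge> max N s" for m n1 n2
      using N(2)[of n1 n2 "m * K + j"] b_per[of m j] that by simp
    with N(1) show ?thesis by (intro exI[of _ "max N s"]) auto
  qed
  have "bipartite_convergent_second (bip_seq F img) K b"
    unfolding bipartite_convergent_second_def
    using K inj[of "s * K"] conv unfolding b_def by blast
  moreover have "attractor (F 1) (b h)" if "even h" for h
    using assms(2) b_mem(1)[OF that] by auto
  moreover have "attractor (F 2) (b h)" if "odd h" for h
    using assms(2) b_mem(2)[OF that] by auto
  moreover have "limit_map (F 2) (b h) = Some (b ((h + 1) mod K))" if "h < K" "even h" for h
    unfolding b_Suc[OF that(1)] by (rule lim1[OF b_mem(1)[OF that(2)]])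
  moreover have "limit_map (F 1) (b h) = Some (b ((h + 1) mod K))" if "h < K" "odd h" for h
    unfolding b_Suc[OF that(1)] by (rule lim2[OF b_mem(2)[OF that(2)]])
  moreover have "map_pow (K div 2) (limit_map (F 1) \<circ>\<^sub>m limit_map (F 2)) (b h) = Some (b h)"
    if "even h" for h
    using pow1[OF b_mem(1)[OF that], of "K div 2"] unfolding b_pow .
  moreover have "map_pow (K div 2) (limit_map (F 2) \<circ>\<^sub>m limit_map (F 1)) (b h) = Some (b h)"
    if "odd h" for h
    using pow2[OF b_mem(2)[OF that], of "K div 2"] unfolding b_pow .
  ultimately show ?thesis
    using even_K by (intro exI[of _ K] exI[of _ b] conjI allI impI) simp_all
qed

end
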